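(* Let $\mu_1<0$ be a real constant, let $n\ge 2$ be an integer, and suppose $h\in C^2((0,\infty))\cap C^1([0,\infty))$ satisfies $$2r^2h(r)h_{rr}(r)=(n-1)h(r)(h(r)-1)+rh_r(r)\big(rh_r(r)-(n-1)\big),\qquad h(r)>0,\qquad \forall r>0,$$ together with $h(0)=1$ and $h_r(0)=\mu_1$. Then the limit $$b_1:=\lim_{r\to\infty}rh(r)\in[0,\infty)$$ exists, with $b_1>0$ when $n\ge 4$. Moreover $$\lim_{r\to\infty}r\left(\frac{rh_r(r)}{h(r)}+1\right)=\left(\frac{n-4}{n-1}\right)b_1.$$
   Context: Functions are real-valued; $h_r$ and $h_{rr}$ denote the first and second derivatives of $h$ in $r$. $C^1([0,\infty))$ means continuously differentiable up to $r=0$, with $h_r(0)$ the one-sided derivative at $0$. *)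

theory Defs
  imports "HOL-Analysis.Analysis"
begin

text \<open>The predicate says that \<open>h\<close> is \<open>C\<^sup>1\<close> on \<open>[0,\<infinity>)\<close> and \<open>C\<^sup>2\<close> on \<open>(0,\<infinity>)\<close>, with first derivative \<open>hr\<close> and
  second derivative \<open>hrr\<close>. Derivatives are taken within \<open>[0,\<infinity>)\<close>, so that \<open>hr 0\<close> is the one-sided
  derivative at 0 (for \<open>r > 0\<close> this is the ordinary derivative); values of \<open>h\<close> at negative
  arguments, and the value \<open>hrr 0\<close>, are irrelevant.\<close>

definition C1_closed_C2_open ::
    "(real \<Rightarrow> real) \<Rightarrow> (real \<Rightarrow> real) \<Rightarrow> (real \<Rightarrow> real) \<Rightarrow> bool" where
  "C1_closed_C2_open h hr hrr \<longleftrightarrow>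
     (\<forall>r\<ge>0. (h has_real_derivative hr r) (at r within {0..})) \<and>
     continuous_on {0..} hr \<and>
     (\<forall>r>0. (hr has_real_derivative hrr r) (at r)) \<and>
     continuous_on {0<..} hrr"

end

theory Submission
  imports Defs
begin

text \<open>In the variable \<open>s = ln r\<close>, put \<open>k = - r h\<^sub>r\<close>, \<open>z = k / h\<close> and
  \<open>p = (1 - z) / h\<close>. A maximum principle gives \<open>k > 0\<close>, so \<open>h\<close> decreases from 1.
  Each of \<open>k\<close>, \<open>z\<close>, \<open>p\<close> solves a relaxation equation \<open>2 h f\<^sub>s = A - B f\<close>, whence successively
  \<open>h \<rightarrow> 0\<close>, \<open>k \<rightarrow> 0\<close>, \<open>z \<rightarrow> 1\<close> and \<open>p \<rightarrow> (n - 4) / (n - 1) < 1\<close>.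
  Finally \<open>g = 1 / (r h)\<close> satisfies \<open>g\<^sub>r = - p / r\<^sup>2\<close> and \<open>g > 1 / r\<close>; integrating from infinity,
  \<open>g\<close> has a limit, and this limit cannot vanish because \<open>p\<close> stays below a constant less than 1.
  So \<open>b\<^sub>1 > 0\<close> for every \<open>n\<close>, and \<open>r (1 - z) = p / g\<close> yields the second limit.\<close>

section \<open>Decay and relaxation estimates in logarithmic time\<close>

text \<open>Since \<open>r * f' r\<close> is the derivative in \<open>ln r\<close>, \<open>f\<close>
  drops at a rate of at least \<open>\<delta>\<close> in logarithmic time wherever it is at or above
  \<open>c\<close>. As \<open>ln r\<close> is unbounded, \<open>f\<close> must reach
  \<open>c\<close>, and afterwards it cannot climb past it.\<close>

lemma eventually_le_of_decay:
  fixes f f' :: "real \<Rightarrow> real"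
  assumes der: "\<forall>\<^sub>F r in at_top. (f has_real_derivative f' r) (at r)"
    and decay: "\<forall>\<^sub>F r in at_top. f r \<ge> c \<longrightarrow> r * f' r \<le> - \<delta>"
    and "\<delta> > 0"
  shows "\<forall>\<^sub>F r in at_top. f r \<le> c"
proof -
  have "\<forall>\<^sub>F r in at_top. (f has_real_derivative f' r) (at r) \<and> (f r \<ge> c \<longrightarrow> r * f' r \<le> - \<delta>)"
    using der decay by eventually_elim auto
  then obtain R0 where R0: "\<And>r. r \<ge> R0 \<Longrightarrow> (f has_real_derivative f' r) (at r) \<and> (f r \<ge> c \<longrightarrow> r * f' r \<le> - \<delta>)"
    unfolding eventually_at_top_linorder by blast
  define R where "R = max 1 R0"
  have "R > 0" and der: "\<And>r. r \<ge> R \<Longrightarrow> (f has_real_derivative f' r) (at r)"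
    and decay: "\<And>r. r \<ge> R \<Longrightarrow> f r \<ge> c \<Longrightarrow> r * f' r \<le> - \<delta>"
    using R0 by (auto simp: R_def)
  have "\<exists>r\<ge>R. f r \<le> c"
  proof (rule ccontr)
    assume "\<not> ?thesis"
    then have above: "f r > c" if "r \<ge> R" for r
      using that by force
    \<comment> \<open>If \<open>f\<close> stayed above \<open>c\<close>, it would lie below a
      constant minus \<open>\<delta> * ln r\<close>, which tends to minus infinity.\<close>
    have bound: "f r + \<delta> * ln r \<le> f R + \<delta> * ln R" if "r \<ge> R" for r
    proof (rule DERIV_nonpos_imp_nonincreasing[of R r "\<lambda>r. f r + \<delta> * ln r"])
      fix x assume x: "R \<le> x" "x \<le> r"
      then have "x > 0"
        using \<open>R > 0\<close> by simp
      have "x * f' x \<le> - \<delta>"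
        using decay above x by (simp add: less_imp_le)
      then have "f' x + \<delta> / x \<le> 0"
        using \<open>x > 0\<close> by (simp add: field_simps)
      moreover have "((\<lambda>r. f r + \<delta> * ln r) has_real_derivative (f' x + \<delta> / x)) (at x)"
        using der[of x] x \<open>x > 0\<close> by (auto intro!: derivative_eq_intros)
      ultimately show "\<exists>y. ((\<lambda>r. f r + \<delta> * ln r) has_real_derivative y) (at x) \<and> y \<le> 0"
        by blast
    qed fact
    have "filterlim (\<lambda>r. \<delta> * ln r) at_top at_top"
      using \<open>\<delta> > 0\<close> ln_at_top by (rule filterlim_tendsto_pos_mult_at_top[OF tendsto_const])
    then have "\<forall>\<^sub>F r in at_top. \<delta> * ln r > f R + \<delta> * ln R - c"
      by (simp add: filterlim_at_top_dense)
    then have "\<forall>\<^sub>F r in at_top. r \<ge> R \<and> \<delta> * ln r > f R + \<delta> * ln R - c"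
      using eventually_ge_at_top[of R] by eventually_elim auto
    then obtain r where "r \<ge> R" "\<delta> * ln r > f R + \<delta> * ln R - c"
      by (auto simp: eventually_at_top_linorder)
    with bound[of r] above[of r] show False
      by simp
  qed
  then obtain r1 where r1: "r1 \<ge> R" "f r1 \<le> c"
    by blast
  have "f r2 \<le> c" if "r2 \<ge> r1" for r2
  proof (rule ccontr)
    assume r2: "\<not> f r2 \<le> c"
    \<comment> \<open>\<open>Sup S\<close> is the last point before \<open>r2\<close> with value at
      most \<open>c\<close>. From there to \<open>r2\<close> the function exceeds \<open>c\<close>,
      so its derivative is negative, and the mean value theorem forbids the rise.\<close>
    define S where "S = {r1..r2} \<inter> f -` {..c}"
    have "continuous_on {r1..r2} f"
      using r1 by (intro DERIV_continuous_on[where D = f'] has_field_derivative_at_within[OF der]) auto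
    then have "closed S"
      unfolding S_def by (rule continuous_closed_preimage) auto
    moreover have "r1 \<in> S" "bdd_above S"
      using r1 that by (auto simp: S_def)
    ultimately have Sup: "Sup S \<in> S"
      by (intro closed_contains_Sup) auto
    define r3 where "r3 = Sup S"
    have r3: "r1 \<le> r3" "f r3 \<le> c" "r3 < r2"
      using Sup r2 by (auto simp: S_def r3_def order.strict_iff_order)
    have above: "f x > c" if "r3 < x" "x \<le> r2" for x
    proof (rule ccontr)
      assume "\<not> c < f x"
      then have "x \<in> S"
        using that r3 by (auto simp: S_def)
      then have "x \<le> r3"
        unfolding r3_def using \<open>bdd_above S\<close> by (rule cSup_upper)
      with that show False by simp
    qed
    obtain x where x: "r3 < x" "x < r2" "f r2 - f r3 = (r2 - r3) * f' x"
      using MVT2[of r3 r2 f f'] der r1 r3 by force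
    have "x * f' x \<le> - \<delta>"
      using decay[of x] above[of x] x r1 r3 by simp
    then have "x * f' x < 0"
      using \<open>\<delta> > 0\<close> by simp
    then have "f' x < 0"
      using x r1 r3 \<open>R > 0\<close> by (simp add: mult_less_0_iff)
    then have "f r2 - f r3 < 0"
      using x by (simp add: mult_less_0_iff)
    with r2 r3 show False by simp
  qed
  then show ?thesis
    by (auto simp: eventually_at_top_linorder)
qed

text \<open>At height \<open>a / b + \<epsilon>\<close> the right-hand side of the equation tends to
  \<open>- b * \<epsilon>\<close>, and larger values of \<open>f\<close> only lower it once
  \<open>B\<close> is positive. Dividing by \<open>2 * h\<close> with \<open>h \<le> 1\<close>
  leaves a decay rate of at least \<open>b * \<epsilon> / 4\<close>.\<close>

lemma relaxation_upper:
  fixes f f' h A B :: "real \<Rightarrow> real"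
  assumes der: "\<forall>\<^sub>F r in at_top. (f has_real_derivative f' r) (at r)"
    and h: "\<forall>\<^sub>F r in at_top. 0 < h r \<and> h r \<le> 1"
    and ode: "\<forall>\<^sub>F r in at_top. 2 * h r * (r * f' r) = A r - B r * f r"
    and A: "(A \<longlongrightarrow> a) at_top" and B: "(B \<longlongrightarrow> b) at_top" and "b > 0" and "\<epsilon> > 0"
  shows "\<forall>\<^sub>F r in at_top. f r \<le> a / b + \<epsilon>"
proof (rule eventually_le_of_decay[OF der, where \<delta> = "b * \<epsilon> / 4"])
  have "((\<lambda>r. A r - B r * (a / b + \<epsilon>)) \<longlongrightarrow> a - b * (a / b + \<epsilon>)) at_top"
    by (intro tendsto_intros A B)
  moreover have "a - b * (a / b + \<epsilon>) < - (b * \<epsilon> / 2)"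
    using \<open>b > 0\<close> \<open>\<epsilon> > 0\<close> by (simp add: field_simps)
  ultimately have "\<forall>\<^sub>F r in at_top. A r - B r * (a / b + \<epsilon>) < - (b * \<epsilon> / 2)"
    by (rule order_tendstoD)
  moreover have "\<forall>\<^sub>F r in at_top. B r > 0"
    using B \<open>b > 0\<close> by (rule order_tendstoD)
  ultimately show "\<forall>\<^sub>F r in at_top. a / b + \<epsilon> \<le> f r \<longrightarrow> r * f' r \<le> - (b * \<epsilon> / 4)"
    using h ode
  proof eventually_elim
    case (elim r)
    show ?case
    proof
      assume "a / b + \<epsilon> \<le> f r"
      then have "B r * (a / b + \<epsilon>) \<le> B r * f r"
        using elim by (intro mult_left_mono) auto
      then have *: "h r * (r * f' r) \<le> - (b * \<epsilon> / 4)"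
        using elim unfolding mult.assoc by linarith
      show "r * f' r \<le> - (b * \<epsilon> / 4)"
      proof (rule ccontr)
        assume "\<not> ?thesis"
        then have "h r * (r * f' r) > h r * - (b * \<epsilon> / 4)"
          using elim by (intro mult_strict_left_mono) auto
        moreover have "h r * (b * \<epsilon> / 4) \<le> 1 * (b * \<epsilon> / 4)"
          using elim \<open>b > 0\<close> \<open>\<epsilon> > 0\<close> by (intro mult_right_mono) auto
        ultimately show False
          using * by simp
      qed
    qed
  qed
  show "b * \<epsilon> / 4 > 0"
    using \<open>b > 0\<close> \<open>\<epsilon> > 0\<close> by simp
qed

text \<open>The equation is preserved when \<open>f\<close> and \<open>A\<close> change sign, so the
  upper bound for \<open>- f\<close> supplies the lower bound for \<open>f\<close>.\<close>

lemma relaxation_tendsto: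
  fixes f f' h A B :: "real \<Rightarrow> real"
  assumes der: "\<forall>\<^sub>F r in at_top. (f has_real_derivative f' r) (at r)"
    and h: "\<forall>\<^sub>F r in at_top. 0 < h r \<and> h r \<le> 1"
    and ode: "\<forall>\<^sub>F r in at_top. 2 * h r * (r * f' r) = A r - B r * f r"
    and A: "(A \<longlongrightarrow> a) at_top" and B: "(B \<longlongrightarrow> b) at_top" and "b > 0"
  shows "(f \<longlongrightarrow> a / b) at_top"
proof (rule tendstoI)
  fix \<epsilon> :: real assume "\<epsilon> > 0"
  then have "\<epsilon> / 2 > 0" by simp
  have "\<forall>\<^sub>F r in at_top. f r \<le> a / b + \<epsilon> / 2"
    by (rule relaxation_upper) fact+
  moreover have "\<forall>\<^sub>F r in at_top. - f r \<le> - a / b + \<epsilon> / 2"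
  proof (rule relaxation_upper[where f = "\<lambda>r. - f r" and A = "\<lambda>r. - A r" and B = B and h = h])
    show "\<forall>\<^sub>F r in at_top. ((\<lambda>r. - f r) has_real_derivative - f' r) (at r)"
      using der by eventually_elim (rule DERIV_minus)
    show "\<forall>\<^sub>F r in at_top. 2 * h r * (r * - f' r) = - A r - B r * - f r"
      using ode by eventually_elim simp
    show "((\<lambda>r. - A r) \<longlongrightarrow> - a) at_top"
      using A by (rule tendsto_minus)
  qed fact+
  ultimately show "\<forall>\<^sub>F r in at_top. dist (f r) (a / b) < \<epsilon>"
  proof eventually_elim
    case (elim r)
    with \<open>\<epsilon> > 0\<close> show ?case
      unfolding dist_real_def abs_less_iff minus_divide_left[symmetric] by linarith
  qed
qed

section \<open>Integration from infinity\<close>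

text \<open>Once \<open>- K \<le> p r \<le> C\<close>, the function \<open>g r - C / r\<close> is
  nondecreasing and \<open>g r + K / r\<close> is nonincreasing, so \<open>g\<close> converges. If
  moreover \<open>C < 1\<close>, the bound \<open>g r \<ge> 1 / r\<close> makes the first function
  positive at some point, and its monotonicity carries this to the limit.\<close>

lemma tendsto_pos_of_deriv_bounds:
  fixes g p :: "real \<Rightarrow> real"
  assumes der: "\<forall>\<^sub>F r in at_top. (g has_real_derivative - p r / r\<^sup>2) (at r)"
    and p: "(p \<longlongrightarrow> c) at_top" and "c < 1"
    and g: "\<forall>\<^sub>F r in at_top. g r \<ge> 1 / r"
  obtains l where "l > 0" "(g \<longlongrightarrow> l) at_top"
proof -
  \<comment> \<open>The midpoint of \<open>c\<close> and 1: it eventually bounds \<open>p\<close>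
    from above and is still less than 1.\<close>
  define C where "C = (c + 1) / 2"
  define K where "K = \<bar>c\<bar> + 1"
  have C: "c < C" "C < 1" and K: "- K < c" "C \<le> K"
    using \<open>c < 1\<close> by (auto simp: C_def K_def)
  have "\<forall>\<^sub>F r in at_top. r \<ge> 1 \<and> (g has_real_derivative - p r / r\<^sup>2) (at r) \<and> p r \<le> C \<and> - K \<le> p r \<and> g r \<ge> 1 / r"
    using der g order_tendstoD(2)[OF p C(1)] order_tendstoD(1)[OF p K(1)] eventually_ge_at_top[of 1]
    by eventually_elim auto
  then obtain R where R: "\<And>r. r \<ge> R \<Longrightarrow> r \<ge> 1 \<and> (g has_real_derivative - p r / r\<^sup>2) (at r)
      \<and> p r \<le> C \<and> - K \<le> p r \<and> g r \<ge> 1 / r"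
    unfolding eventually_at_top_linorder by blast
  have R1: "R \<ge> 1"
    using R by blast
  have der': "((\<lambda>r. g r + d / r) has_real_derivative (- p r - d) / r\<^sup>2) (at r)" if "r \<ge> R" for r d
    using R[OF that] by (auto intro!: derivative_eq_intros simp: field_simps power2_eq_square)
  have up: "g x - C / x \<le> g y - C / y" if "R \<le> x" "x \<le> y" for x y
  proof -
    have "g x + (- C) / x \<le> g y + (- C) / y"
    proof (rule DERIV_nonneg_imp_nondecreasing[OF that(2)])
      fix t assume "x \<le> t" "t \<le> y"
      then have "R \<le> t" using that by simp
      then show "\<exists>w. ((\<lambda>r. g r + (- C) / r) has_real_derivative w) (at t) \<and> w \<ge> 0"
        using der'[of t "- C"] R[of t] by (intro exI[of _ "(- p t - (- C)) / t\<^sup>2"]) auto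
    qed
    then show ?thesis by simp
  qed
  have down: "g y + K / y \<le> g x + K / x" if "R \<le> x" "x \<le> y" for x y
  proof (rule DERIV_nonpos_imp_nonincreasing[OF that(2)])
    fix t assume "x \<le> t" "t \<le> y"
    then have "R \<le> t" using that by simp
    then show "\<exists>w. ((\<lambda>r. g r + K / r) has_real_derivative w) (at t) \<and> w \<le> 0"
      using der'[of t K] R[of t]
      by (intro exI[of _ "(- p t - K) / t\<^sup>2"]) (auto intro!: divide_nonpos_nonneg)
  qed
  \<comment> \<open>Freezing the argument at \<open>R\<close> makes \<open>u\<close> monotone on the
    whole line, so its limit is the supremum over all reals.\<close>
  define u where "u = (\<lambda>r. g (max R r) - C / max R r)"
  have "mono u"
    unfolding u_def by (intro monoI up) auto
  have bound: "u r \<le> g R + K / R + \<bar>C\<bar>" for r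
  proof -
    have "- C / max R r \<le> \<bar>C\<bar>"
    proof -
      have "\<bar>C\<bar> / max R r \<le> \<bar>C\<bar>"
        using R1 by (simp add: divide_le_eq mult_le_cancel_left1 le_max_iff_disj)
      moreover have "- C / max R r \<le> \<bar>C\<bar> / max R r"
        using R1 by (intro divide_right_mono) auto
      ultimately show ?thesis by linarith
    qed
    moreover have "0 \<le> K / max R r"
      using R1 by (simp add: K_def)
    ultimately show ?thesis
      using down[of R "max R r"] unfolding u_def by simp
  qed
  define l where "l = (SUP r. u r)"
  have le: "u r \<le> l" for r
    unfolding l_def by (rule cSUP_upper) (auto intro!: bdd_aboveI2 bound)
  have u: "(u \<longlongrightarrow> l) at_top"
  proof (rule increasing_tendsto)
    show "\<forall>\<^sub>F r in at_top. u r \<le> l"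
      using le by simp
    fix x assume "x < l"
    then obtain r0 where "x < u r0"
      unfolding l_def by (subst (asm) less_cSUP_iff) (auto intro!: bdd_aboveI2 bound)
    then show "\<forall>\<^sub>F r in at_top. x < u r"
      using \<open>mono u\<close> by (auto simp: eventually_at_top_linorder mono_def intro!: exI[of _ r0] intro: less_le_trans)
  qed
  have "((\<lambda>r. u r + C / r) \<longlongrightarrow> l + 0) at_top"
    by (intro tendsto_add u real_tendsto_divide_at_top[OF tendsto_const] filterlim_ident)
  moreover have "\<forall>\<^sub>F r in at_top. u r + C / r = g r"
    using eventually_ge_at_top[of R] by eventually_elim (simp add: u_def max_def)
  ultimately have "(g \<longlongrightarrow> l) at_top"
    by (simp add: filterlim_cong)
  moreover have "l > 0"
  proof -
    have "0 < (1 - C) / R"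
      using C R1 by simp
    also have "\<dots> \<le> g R - C / R"
      using R[of R] by (simp add: diff_divide_distrib)
    also have "\<dots> \<le> l"
      using le[of R] by (simp add: u_def)
    finally show ?thesis .
  qed
  ultimately show ?thesis
    using that by blast
qed

section \<open>Monotonicity of the profile\<close>

text \<open>Here \<open>m\<close> stands for \<open>n - 1\<close>, treated as a positive
  real.\<close>

locale decreasing_profile =
  fixes \<mu> m :: real and h hr hrr :: "real \<Rightarrow> real"
  assumes \<mu>: "\<mu> < 0" and m: "m > 0"
    and regular: "C1_closed_C2_open h hr hrr"
    and ode: "\<And>r. r > 0 \<Longrightarrow>
           2 * r\<^sup>2 * h r * hrr r = m * h r * (h r - 1) + r * hr r * (r * hr r - m)"
    and h_pos: "\<And>r. r > 0 \<Longrightarrow> h r > 0"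
    and h_0: "h 0 = 1" and hr_0: "hr 0 = \<mu>"
begin

lemma h_has_derivative_within: "r \<ge> 0 \<Longrightarrow> (h has_real_derivative hr r) (at r within {0..})"
  using regular by (simp add: C1_closed_C2_open_def)

lemma h_has_derivative [derivative_intros]: "r > 0 \<Longrightarrow> (h has_real_derivative hr r) (at r)"
  using h_has_derivative_within[of r] at_within_interior[of r "{0..}"] by simp

lemma hr_has_derivative [derivative_intros]: "r > 0 \<Longrightarrow> (hr has_real_derivative hrr r) (at r)"
  using regular by (simp add: C1_closed_C2_open_def)

lemma continuous_on_h: "continuous_on {0..} h"
  by (rule DERIV_continuous_on[OF h_has_derivative_within]) simp

lemma continuous_on_hr: "continuous_on {0..} hr"
  using regular by (simp add: C1_closed_C2_open_def)

text \<open>Negativity is asked only on the open interval, so that the lemma can be applied up to a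
  first zero of \<open>hr\<close>.\<close>

lemma h_less_if_hr_neg:
  assumes "0 \<le> x" "x < y" and neg: "\<And>t. x < t \<Longrightarrow> t < y \<Longrightarrow> hr t < 0"
  shows "h y < h x"
  using assms(2)
proof (rule DERIV_neg_imp_decreasing_open)
  show "continuous_on {x..y} h"
    using continuous_on_h by (rule continuous_on_subset) (use assms in auto)
  fix t assume "x < t" "t < y"
  then show "\<exists>w. (h has_real_derivative w) (at t) \<and> w < 0"
    using neg h_has_derivative[of t] assms by force
qed

text \<open>A maximum principle. At a first zero \<open>q\<close> of \<open>hr\<close> the function
  \<open>h\<close> has already dropped below 1, so the equation reduces to a strict inequality
  \<open>hrr q < 0\<close>. Then \<open>hr\<close> would be positive just to the left of
  \<open>q\<close>, against the choice of \<open>q\<close>.\<close>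

lemma hr_neg:
  assumes "r \<ge> 0" shows "hr r < 0"
proof (rule ccontr)
  assume nonneg: "\<not> hr r < 0"
  define S where "S = {0..} \<inter> hr -` {0..}"
  have "closed S"
    unfolding S_def using continuous_on_hr
    by (rule continuous_closed_preimage) auto
  moreover have "r \<in> S" and bdd: "bdd_below S"
    using nonneg assms by (auto simp: S_def)
  ultimately have Inf: "Inf S \<in> S"
    by (intro closed_contains_Inf) auto
  define q where "q = Inf S"
  have q: "0 < q" "hr q \<ge> 0"
    using Inf hr_0 \<mu> by (auto simp: S_def q_def order.strict_iff_order)
  have neg: "hr t < 0" if "0 \<le> t" "t < q" for t
  proof (rule ccontr)
    assume "\<not> hr t < 0"
    then have "t \<in> S" using that by (simp add: S_def)
    then have "q \<le> t" unfolding q_def using bdd by (rule cInf_lower)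
    with that show False by simp
  qed
  \<comment> \<open>As a limit of negative values from the left.\<close>
  have "hr q \<le> 0"
  proof (rule tendsto_upperbound)
    show "(hr \<longlongrightarrow> hr q) (at_left q)"
      using DERIV_isCont[OF hr_has_derivative[OF q(1)]]
      by (auto simp: isCont_def intro: filterlim_mono at_le)
    show "\<forall>\<^sub>F t in at_left q. hr t \<le> 0"
      using q neg by (auto simp: eventually_at_left[OF q(1)] intro!: exI[of _ 0] less_imp_le)
  qed simp
  then have hr_q: "hr q = 0"
    using q by simp
  have "h q < 1"
    using h_less_if_hr_neg[of 0 q] q neg h_0 by simp
  then have "m * h q * (h q - 1) < 0"
    using m h_pos[OF q(1)] by (simp add: mult_less_0_iff zero_less_mult_iff)
  then have "2 * q\<^sup>2 * h q * hrr q < 0"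
    using ode[OF q(1)] unfolding hr_q by linarith
  then have "hrr q < 0"
    using q h_pos[OF q(1)] by (simp add: mult_less_0_iff zero_less_mult_iff)
  then obtain d where d: "d > 0" "\<And>e. 0 < e \<Longrightarrow> e < d \<Longrightarrow> hr q < hr (q - e)"
    using DERIV_neg_dec_left[OF hr_has_derivative[OF q(1)]] by blast
  define e where "e = min (d / 2) (q / 2)"
  have "0 < e" "e < d" "e < q"
    using d q by (auto simp: e_def min_def)
  then show False
    using d(2)[of e] neg[of "q - e"] hr_q by simp
qed

lemma h_strict_antimono: "0 \<le> x \<Longrightarrow> x < y \<Longrightarrow> h y < h x"
  by (intro h_less_if_hr_neg hr_neg) auto

lemma h_less_1: "r > 0 \<Longrightarrow> h r < 1"
  using h_strict_antimono[of 0 r] h_0 by simp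

section \<open>Decay of the profile and of its logarithmic derivative\<close>

text \<open>With \<open>s = ln r\<close> this is minus the derivative of \<open>h\<close> in
  \<open>s\<close>. The primed functions here and below are derivatives in \<open>r\<close>.\<close>

definition k :: "real \<Rightarrow> real" where "k r = - r * hr r"
definition k' :: "real \<Rightarrow> real" where "k' r = - hr r - r * hrr r"

lemma k_pos: "r > 0 \<Longrightarrow> k r > 0"
  using hr_neg[of r] by (simp add: k_def mult_less_0_iff)

lemma k_has_derivative: "r > 0 \<Longrightarrow> (k has_real_derivative k' r) (at r)"
  unfolding k_def[abs_def] k'_def by (auto intro!: derivative_eq_intros)

lemma k_ode:
  assumes "r > 0"
  shows "2 * h r * (r * k' r) = m * h r * (1 - h r) - (m + k r - 2 * h r) * k r"
  using ode[OF assms] unfolding k_def k'_def by (simp add: algebra_simps power2_eq_square)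

text \<open>By monotonicity one small value of \<open>h\<close> suffices. If \<open>h\<close> stayed
  above \<open>\<epsilon>\<close>, the source term \<open>m * h r * (1 - h r)\<close> would push
  \<open>k\<close> above a fixed \<open>\<delta>\<close>, and then \<open>h\<close> would fall at
  least at rate \<open>\<delta>\<close> in \<open>ln r\<close>.\<close>

lemma h_tendsto_0: "(h \<longlongrightarrow> 0) at_top"
proof -
  have small: "\<forall>\<^sub>F r in at_top. h r \<le> \<epsilon>" if "\<epsilon> > 0" for \<epsilon>
  proof (cases "\<exists>r>0. h r \<le> \<epsilon>")
    case True
    then obtain r where r: "r > 0" "h r \<le> \<epsilon>" by blast
    show ?thesis
      using eventually_gt_at_top[of r]
    proof eventually_elim
      case (elim x)
      then show ?case
        using h_strict_antimono[of r x] r by simp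
    qed
  next
    case False
    then have large: "h r > \<epsilon>" if "r > 0" for r
      using that by force
    \<comment> \<open>A lower bound for the source term in \<open>k_ode\<close> when
      \<open>r > 1\<close>. The number \<open>\<delta>\<close> below is chosen so that, for
      \<open>k r \<le> \<delta>\<close>, the damping term consumes at most half of it.\<close>
    define c where "c = m * \<epsilon> * (1 - h 1)"
    have "c > 0"
      using m \<open>\<epsilon> > 0\<close> h_less_1[of 1] by (simp add: c_def)
    define \<delta> where "\<delta> = min 1 (c / (2 * (m + 1)))"
    have "\<delta> > 0" "\<delta> \<le> 1"
      using \<open>c > 0\<close> m by (auto simp: \<delta>_def)
    have "\<delta> \<le> c / (2 * (m + 1))"
      by (simp add: \<delta>_def)
    then have \<delta>: "(m + 1) * \<delta> \<le> c / 2"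
      using m by (simp add: field_simps)
    have "\<forall>\<^sub>F r in at_top. - k r \<le> - \<delta>"
    proof (rule eventually_le_of_decay[where f' = "\<lambda>r. - k' r" and \<delta> = "c / 4"])
      show "\<forall>\<^sub>F r in at_top. ((\<lambda>r. - k r) has_real_derivative - k' r) (at r)"
        using eventually_gt_at_top[of 0] by eventually_elim (intro DERIV_minus k_has_derivative)
      show "\<forall>\<^sub>F r in at_top. - \<delta> \<le> - k r \<longrightarrow> r * - k' r \<le> - (c / 4)"
        using eventually_gt_at_top[of 1]
      proof eventually_elim
        case (elim r)
        show ?case
        proof
          assume "- \<delta> \<le> - k r"
          then have kr: "0 < k r" "k r \<le> \<delta>"
            using k_pos[of r] elim by auto
          have hr: "0 < h r" "h r < 1" "\<epsilon> < h r" "h r < h 1"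
            using elim h_pos[of r] h_less_1[of r] large[of r] h_strict_antimono[of 1 r] by auto
          have "c \<le> m * h r * (1 - h r)"
            unfolding c_def using m \<open>\<epsilon> > 0\<close> hr h_less_1[of 1]
            by (intro mult_mono) auto
          moreover have "(m + k r - 2 * h r) * k r \<le> (m + 1) * \<delta>"
            using m kr hr \<open>\<delta> \<le> 1\<close> by (intro mult_mono) auto
          ultimately have *: "h r * (r * k' r) \<ge> c / 4"
            using k_ode[of r] elim \<delta> by simp
          then have "0 < h r * (r * k' r)"
            using \<open>c > 0\<close> by simp
          then have "0 < r * k' r"
            using hr by (simp add: zero_less_mult_iff)
          then have "h r * (r * k' r) \<le> 1 * (r * k' r)"
            using hr by (intro mult_right_mono) auto
          with * show "r * - k' r \<le> - (c / 4)"
            by simp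
        qed
      qed
    qed (use \<open>c > 0\<close> in simp)
    then have "\<forall>\<^sub>F r in at_top. \<epsilon> \<le> h r \<longrightarrow> r * hr r \<le> - \<delta>"
      by eventually_elim (simp add: k_def)
    \<comment> \<open>The decay lemma is now applied a second time, to \<open>h\<close>
      itself.\<close>
    with _ show ?thesis
      using \<open>\<delta> > 0\<close>
    proof (rule eventually_le_of_decay)
      show "\<forall>\<^sub>F r in at_top. (h has_real_derivative hr r) (at r)"
        using eventually_gt_at_top[of 0] by eventually_elim (rule h_has_derivative)
    qed
  qed
  show ?thesis
  proof (rule decreasing_tendsto)
    show "\<forall>\<^sub>F r in at_top. 0 \<le> h r"
      using eventually_gt_at_top[of 0] by eventually_elim (rule less_imp_le, rule h_pos)
    fix x :: real assume "0 < x"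
    then have "\<forall>\<^sub>F r in at_top. h r \<le> x / 2"
      by (intro small) simp
    then show "\<forall>\<^sub>F r in at_top. h r < x"
      by eventually_elim (use \<open>0 < x\<close> in linarith)
  qed
qed

lemma h_bounds: "\<forall>\<^sub>F r in at_top. 0 < h r \<and> h r \<le> 1"
  using eventually_gt_at_top[of 0]
  by eventually_elim (use h_pos h_less_1 in \<open>force intro: less_imp_le\<close>)

text \<open>The damping coefficient in \<open>k_ode\<close> contains \<open>k\<close>, so its limit
  is not yet known. Positivity of \<open>k\<close> and smallness of \<open>h\<close> bound it below
  by \<open>m / 2\<close>, which is enough for the decay lemma.\<close>

lemma k_tendsto_0: "(k \<longlongrightarrow> 0) at_top"
proof (rule decreasing_tendsto)
  show "\<forall>\<^sub>F r in at_top. 0 \<le> k r"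
    using eventually_gt_at_top[of 0] by eventually_elim (rule less_imp_le, rule k_pos)
  fix x :: real assume "0 < x"
  define e where "e = x / 2"
  have e: "0 < e" "e < x" using \<open>0 < x\<close> by (auto simp: e_def)
  have "\<forall>\<^sub>F r in at_top. k r \<le> e"
  proof (rule eventually_le_of_decay[where f' = k' and \<delta> = "m * e / 8"])
    show "\<forall>\<^sub>F r in at_top. (k has_real_derivative k' r) (at r)"
      using eventually_gt_at_top[of 0] by eventually_elim (rule k_has_derivative)
    \<comment> \<open>The first threshold keeps the source below \<open>m * e / 4\<close>, the
      second keeps the damping above \<open>m * e / 2\<close> when
      \<open>k r \<ge> e\<close>.\<close>
    have "\<forall>\<^sub>F r in at_top. h r < e / 4" "\<forall>\<^sub>F r in at_top. h r < m / 4"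
      using e m by (intro order_tendstoD(2)[OF h_tendsto_0]; simp)+
    then show "\<forall>\<^sub>F r in at_top. e \<le> k r \<longrightarrow> r * k' r \<le> - (m * e / 8)"
      using eventually_gt_at_top[of 0]
    proof eventually_elim
      case (elim r)
      have hr: "0 < h r" "h r < 1"
        using elim by (auto simp: h_pos h_less_1)
      show ?case
      proof
        assume "e \<le> k r"
        then have "(m / 2) * e \<le> (m + k r - 2 * h r) * k r"
          using elim e m by (intro mult_mono) auto
        moreover have "m * h r * (1 - h r) \<le> m * (e / 4) * 1"
          using elim hr m by (intro mult_mono) auto
        ultimately have *: "h r * (r * k' r) \<le> - (m * e / 8)"
          using k_ode[of r] elim by simp
        moreover have "m * e > 0"
          using m e by simp
        ultimately have "h r * (r * k' r) < 0"
          by linarith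
        then have "r * k' r < 0"
          using hr by (simp add: mult_less_0_iff)
        then have "1 * (r * k' r) \<le> h r * (r * k' r)"
          using hr by (intro mult_right_mono_neg) auto
        with * show "r * k' r \<le> - (m * e / 8)" by simp
      qed
    qed
    show "m * e / 8 > 0" using m e by simp
  qed
  then show "\<forall>\<^sub>F r in at_top. k r < x"
    by eventually_elim (use e in linarith)
qed

section \<open>Limits of the rescaled quantities\<close>

text \<open>Minus the derivative of \<open>ln h\<close> in \<open>ln r\<close>; its limit 1
  expresses decay of \<open>h\<close> like \<open>1 / r\<close> to leading order in the
  exponent.\<close>

definition z :: "real \<Rightarrow> real" where "z r = k r / h r"
definition z' :: "real \<Rightarrow> real" where "z' r = (k' r * h r - k r * hr r) / (h r)\<^sup>2"

lemma z_has_derivative: "r > 0 \<Longrightarrow> (z has_real_derivative z' r) (at r)"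
  unfolding z_def[abs_def] z'_def using h_pos[of r]
  by (auto intro!: derivative_eq_intros k_has_derivative simp: power2_eq_square)

text \<open>Replacing \<open>h r * z r\<close> by \<open>k r\<close> gives coefficients whose limits
  follow from those of \<open>h\<close> and \<open>k\<close>.\<close>

lemma z_ode:
  assumes "r > 0"
  shows "2 * h r * (r * z' r) = (m - m * h r + 2 * k r) - (m - k r) * z r"
proof -
  have pos: "h r > 0" using assms by (rule h_pos)
  have "2 * h r * (r * z' r) = (2 * h r * (r * k' r) + 2 * k r * k r) / h r"
    using pos by (simp add: z'_def k_def field_simps power2_eq_square)
  also have "\<dots> = (m - m * h r + 2 * k r) - (m - k r) * z r"
    unfolding k_ode[OF assms] z_def using pos by (simp add: field_simps)
  finally show ?thesis .
qed

lemma z_tendsto_1: "(z \<longlongrightarrow> 1) at_top"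
proof -
  have "(z \<longlongrightarrow> (m - m * 0 + 2 * 0) / (m - 0)) at_top"
  proof (rule relaxation_tendsto[OF _ h_bounds])
    show "\<forall>\<^sub>F r in at_top. (z has_real_derivative z' r) (at r)"
      using eventually_gt_at_top[of 0] by eventually_elim (rule z_has_derivative)
    show "\<forall>\<^sub>F r in at_top. 2 * h r * (r * z' r) = (m - m * h r + 2 * k r) - (m - k r) * z r"
      using eventually_gt_at_top[of 0] by eventually_elim (rule z_ode)
    show "((\<lambda>r. m - m * h r + 2 * k r) \<longlongrightarrow> m - m * 0 + 2 * 0) at_top"
      "((\<lambda>r. m - k r) \<longlongrightarrow> m - 0) at_top"
      by (intro tendsto_intros h_tendsto_0 k_tendsto_0)+
  qed (use m in simp)
  then show ?thesis
    using m by simp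
qed

definition p :: "real \<Rightarrow> real" where "p r = (1 - z r) / h r"
definition p' :: "real \<Rightarrow> real" where "p' r = (- z' r * h r - (1 - z r) * hr r) / (h r)\<^sup>2"

lemma p_has_derivative: "r > 0 \<Longrightarrow> (p has_real_derivative p' r) (at r)"
  unfolding p_def[abs_def] p'_def using h_pos[of r]
  by (auto intro!: derivative_eq_intros z_has_derivative simp: power2_eq_square)

text \<open>The source is \<open>m - 3 * (z r)\<^sup>2\<close>, expanded around
  \<open>z r = 1\<close>. Division by \<open>h\<close> leaves no singular term besides
  \<open>m * p r\<close>, because \<open>k r = z r * h r\<close>.\<close>

lemma p_ode:
  assumes "r > 0"
  shows "2 * h r * (r * p' r) = (m - 3 + 6 * (1 - z r) - 3 * (1 - z r)\<^sup>2) - m * p r"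
proof -
  have pos: "h r > 0" using assms by (rule h_pos)
  have k: "k r = z r * h r" using pos by (simp add: z_def)
  have "2 * h r * (r * p' r) = (- (2 * h r * (r * z' r)) + 2 * (1 - z r) * k r) / h r"
    using pos by (simp add: p'_def k_def field_simps power2_eq_square)
  also have "\<dots> = (m - 3 + 6 * (1 - z r) - 3 * (1 - z r)\<^sup>2) - m * p r"
    unfolding z_ode[OF assms] p_def k using pos by (simp add: field_simps power2_eq_square)
  finally show ?thesis .
qed

lemma p_tendsto: "(p \<longlongrightarrow> (m - 3) / m) at_top"
proof -
  have "(p \<longlongrightarrow> (m - 3 + 6 * (1 - 1) - 3 * (1 - 1)\<^sup>2) / m) at_top"
  proof (rule relaxation_tendsto[OF _ h_bounds])
    show "\<forall>\<^sub>F r in at_top. (p has_real_derivative p' r) (at r)"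
      using eventually_gt_at_top[of 0] by eventually_elim (rule p_has_derivative)
    show "\<forall>\<^sub>F r in at_top. 2 * h r * (r * p' r) = (m - 3 + 6 * (1 - z r) - 3 * (1 - z r)\<^sup>2) - m * p r"
      using eventually_gt_at_top[of 0] by eventually_elim (rule p_ode)
    show "((\<lambda>r. m - 3 + 6 * (1 - z r) - 3 * (1 - z r)\<^sup>2)
        \<longlongrightarrow> m - 3 + 6 * (1 - 1) - 3 * (1 - 1)\<^sup>2) at_top"
      by (intro tendsto_intros z_tendsto_1)
  qed (use m in auto)
  then show ?thesis by simp
qed

section \<open>The two limits\<close>

theorem asymptotics:
  obtains b where "b > 0" "((\<lambda>r. r * h r) \<longlongrightarrow> b) at_top"
    "((\<lambda>r. r * (r * hr r / h r + 1)) \<longlongrightarrow> (m - 3) / m * b) at_top"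
proof -
  define g where "g = (\<lambda>r. 1 / (r * h r))"
  obtain l where l: "l > 0" "(g \<longlongrightarrow> l) at_top"
  proof (rule tendsto_pos_of_deriv_bounds[OF _ p_tendsto])
    show "\<forall>\<^sub>F r in at_top. (g has_real_derivative - p r / r\<^sup>2) (at r)"
      using eventually_gt_at_top[of 0]
    proof eventually_elim
      case (elim r)
      have "h r > 0" using elim by (rule h_pos)
      then show ?case
        unfolding g_def using elim
        by (auto intro!: derivative_eq_intros simp: p_def z_def k_def field_simps power2_eq_square)
    qed
    show "(m - 3) / m < 1"
      using m by simp
    show "\<forall>\<^sub>F r in at_top. 1 / r \<le> g r"
      using eventually_gt_at_top[of 0]
    proof eventually_elim
      case (elim r)
      then show ?case
        using h_pos[of r] h_less_1[of r] by (simp add: g_def field_simps)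
    qed
  qed
  have y: "((\<lambda>r. r * h r) \<longlongrightarrow> 1 / l) at_top"
    using tendsto_divide[OF tendsto_const[of 1] l(2)] l(1) by (simp add: g_def)
  have "((\<lambda>r. p r * (r * h r)) \<longlongrightarrow> (m - 3) / m * (1 / l)) at_top"
    by (intro tendsto_mult p_tendsto y)
  \<comment> \<open>Both sides equal \<open>r * (1 - z r)\<close>.\<close>
  moreover have "\<forall>\<^sub>F r in at_top. p r * (r * h r) = r * (r * hr r / h r + 1)"
    using eventually_gt_at_top[of 0]
  proof eventually_elim
    case (elim r)
    then show ?case
      using h_pos[of r] by (simp add: p_def z_def k_def field_simps)
  qed
  ultimately have "((\<lambda>r. r * (r * hr r / h r + 1)) \<longlongrightarrow> (m - 3) / m * (1 / l)) at_top"
    by (rule Lim_transform_eventually)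
  with y l(1) show ?thesis
    by (intro that[of "1 / l"]) auto
qed

end

theorem theorem1p7:
  fixes \<mu>\<^sub>1 :: real and n :: nat and h hr hrr :: "real \<Rightarrow> real"
  assumes "\<mu>\<^sub>1 < 0" and "n \<ge> 2"
    and "C1_closed_C2_open h hr hrr"
    and "\<And>r. r > 0 \<Longrightarrow>
           2 * r\<^sup>2 * h r * hrr r =
             (real n - 1) * h r * (h r - 1) + r * hr r * (r * hr r - (real n - 1))"
    and "\<And>r. r > 0 \<Longrightarrow> h r > 0"
    and "h 0 = 1" and "hr 0 = \<mu>\<^sub>1"
  shows "\<exists>b\<^sub>1::real. b\<^sub>1 \<ge> 0 \<and>
           ((\<lambda>r. r * h r) \<longlongrightarrow> b\<^sub>1) at_top \<and>
           (n \<ge> 4 \<longrightarrow> b\<^sub>1 > 0) \<and>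
           ((\<lambda>r. r * (r * hr r / h r + 1)) \<longlongrightarrow> (real n - 4) / (real n - 1) * b\<^sub>1) at_top"
proof -
  interpret decreasing_profile \<mu>\<^sub>1 "real n - 1" h hr hrr
    using assms by unfold_locales auto
  \<comment> \<open>Rewrites the factor \<open>(m - 3) / m\<close> for
    \<open>m = n - 1\<close>.\<close>
  have "real n - 1 - 3 = real n - 4"
    by simp
  with asymptotics obtain b where "b > 0" "((\<lambda>r. r * h r) \<longlongrightarrow> b) at_top"
    "((\<lambda>r. r * (r * hr r / h r + 1)) \<longlongrightarrow> (real n - 4) / (real n - 1) * b) at_top"
    by metis
  then show ?thesis
    by (intro exI[of _ b]) simp
qed

end
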